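(* Let $A,B,C,D$ be signed sets and let $f:A\Rrightarrow B$, $g:B\Rrightarrow C$, $h:C\Rrightarrow D$ be cobordisms. Then $$(f\triangleleft g)\triangleleft h = f\triangleleft(g\triangleleft h): A\Rrightarrow D,$$ and, denoting this common cobordism by $f\triangleleft g\triangleleft h$, $$|f\triangleleft g\triangleleft h|=\operatorname{cancel}(|B|+|C|,\ |f|+|g|+|h|): A^+ + D^-\Rrightarrow A^- + D^+ .$$
   Context: A matching is a bijection between finite sets, written $P\Rrightarrow Q$. $X+Y$ denotes disjoint union, treated as strictly commutative and associative by the usual identifications; $X,Y$ are regarded as subsets of $X+Y$. For matchings $u:P\Rrightarrow Q$ and $v:R\Rrightarrow S$, $u+v:P+R\Rrightarrow Q+S$ is their disjoint union. Cancellation: if $F:P+E\Rrightarrow Q+E$ is a matching of finite sets (the two copies of $E$ being identified), then $\operatorname{cancel}(E,F):P\Rrightarrow Q$ is the matching sending $p$ to the first element outside the summand $E$ among $F(p),F(F(p)),\dots$. A signed set is an ordered pair $A=\langle A^+,A^-\rangle$ of finite sets; $|A|=A^+ + A^-$. A cobordism $f:A\Rrightarrow B$ of signed sets is a triple $(|f|,A,B)$ where $|f|:A^+ + B^-\Rrightarrow A^- + B^+$ is a matching. Composition (in natural order, "$f$ then $g$"): for cobordisms $f:A\Rrightarrow B$ and $g:B\Rrightarrow C$, the disjoint union gives a matching $|f|+|g|: A^+ + |B| + C^-\Rrightarrow A^- + |B| + C^+$, and $f\triangleleft g:A\Rrightarrow C$ is the cobordism with $|f\triangleleft g|=\operatorname{cancel}(|B|,|f|+|g|):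 A^+ + C^-\Rrightarrow A^- + C^+$. Similarly, $|f|+|g|+|h|$ is regarded as a matching $A^+ + |B|+|C| + D^-\Rrightarrow A^- + |B|+|C| + D^+$. (The sets at different positions in a chain are treated as separate summands even if they happen to be equal.) *)

theory Defs
  imports Main "HOL-Library.FuncSet"
begin

text \<open>
  Disjoint unions are sums \<open><+>\<close> over sum types, so that summands at different positions are
  separate by construction. Matchings are extensional functions, so that equality of functions is
  equality of matchings.
\<close>

definition matching :: "('p \<Rightarrow> 'q) \<Rightarrow> 'p set \<Rightarrow> 'q set \<Rightarrow> bool" where
  "matching u P Q \<longleftrightarrow> finite P \<and> finite Q \<and> bij_betw u P Q \<and> u \<in> extensional P"

text \<open>
  For a matching \<open>F\<close> from \<open>P <+> E\<close> to \<open>Q <+> E\<close>; the set \<open>P\<close> is an argument only because a HOL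
  function does not carry its domain.
\<close>

definition cancel :: "'x set \<Rightarrow> 'e set \<Rightarrow> ('x + 'e \<Rightarrow> 'x + 'e) \<Rightarrow> 'x \<Rightarrow> 'x" where
  "cancel P E F =
    (\<lambda>p\<in>P. projl ((F ^^ (LEAST n. 0 < n \<and> (F ^^ n) (Inl p) \<notin> Inr ` E)) (Inl p)))"

datatype 'a signed_set = Signed_Set (pos: "'a set") (neg: "'a set")

definition finite_signed :: "'a signed_set \<Rightarrow> bool" where
  "finite_signed A \<longleftrightarrow> finite (pos A) \<and> finite (neg A)"

definition total_set :: "'a signed_set \<Rightarrow> ('a + 'a) set" where
  "total_set A = pos A <+> neg A"

datatype ('a, 'b) cobordism =
  Cobordism (match: "'a + 'b \<Rightarrow> 'a + 'b") (src: "'a signed_set") (tgt: "'b signed_set")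

definition is_cobordism :: "('a, 'b) cobordism \<Rightarrow> 'a signed_set \<Rightarrow> 'b signed_set \<Rightarrow> bool" where
  "is_cobordism f A B \<longleftrightarrow> src f = A \<and> tgt f = B \<and> finite_signed A \<and> finite_signed B \<and>
    matching (match f) (pos A <+> neg B) (neg A <+> pos B)"

text \<open>
  The rearrangements of summands for two cobordisms \<open>f\<close> from \<open>A\<close> to \<open>B\<close> and \<open>g\<close> from \<open>B\<close> to \<open>C\<close>.
  In the source of \<open>|f| + |g|\<close>, the positive part of \<open>B\<close> belongs to \<open>g\<close> and the negative part to
  \<open>f\<close>; in the target it is the other way round.
\<close>

fun split2 :: "('a + 'c) + ('b + 'b) \<Rightarrow> ('a + 'b) + ('b + 'c)" where
  "split2 (Inl (Inl a)) = Inl (Inl a)"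
| "split2 (Inl (Inr c)) = Inr (Inr c)"
| "split2 (Inr (Inl b)) = Inr (Inl b)"
| "split2 (Inr (Inr b)) = Inl (Inr b)"

fun gather2 :: "('a + 'b) + ('b + 'c) \<Rightarrow> ('a + 'c) + ('b + 'b)" where
  "gather2 (Inl (Inl a)) = Inl (Inl a)"
| "gather2 (Inl (Inr b)) = Inr (Inl b)"
| "gather2 (Inr (Inl b)) = Inr (Inr b)"
| "gather2 (Inr (Inr c)) = Inl (Inr c)"

definition join2 ::
  "('a, 'b) cobordism \<Rightarrow> ('b, 'c) cobordism \<Rightarrow> ('a + 'c) + ('b + 'b) \<Rightarrow> ('a + 'c) + ('b + 'b)"
where
  "join2 f g = restrict (gather2 \<circ> map_sum (match f) (match g) \<circ> split2)
    ((pos (src f) <+> neg (tgt g)) <+> total_set (tgt f))"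

definition compose_cob ::
  "('a, 'b) cobordism \<Rightarrow> ('b, 'c) cobordism \<Rightarrow> ('a, 'c) cobordism" (infixl "\<triangleleft>" 70)
where
  "f \<triangleleft> g = Cobordism
    (cancel (pos (src f) <+> neg (tgt g)) (total_set (tgt f)) (join2 f g)) (src f) (tgt g)"

fun split3 ::
  "('a + 'd) + (('b + 'b) + ('c + 'c)) \<Rightarrow> (('a + 'b) + ('b + 'c)) + ('c + 'd)"
where
  "split3 (Inl (Inl a)) = Inl (Inl (Inl a))"
| "split3 (Inl (Inr d)) = Inr (Inr d)"
| "split3 (Inr (Inl (Inl b))) = Inl (Inr (Inl b))"
| "split3 (Inr (Inl (Inr b))) = Inl (Inl (Inr b))"
| "split3 (Inr (Inr (Inl c))) = Inr (Inl c)"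
| "split3 (Inr (Inr (Inr c))) = Inl (Inr (Inr c))"

fun gather3 ::
  "(('a + 'b) + ('b + 'c)) + ('c + 'd) \<Rightarrow> ('a + 'd) + (('b + 'b) + ('c + 'c))"
where
  "gather3 (Inl (Inl (Inl a))) = Inl (Inl a)"
| "gather3 (Inl (Inl (Inr b))) = Inr (Inl (Inl b))"
| "gather3 (Inl (Inr (Inl b))) = Inr (Inl (Inr b))"
| "gather3 (Inl (Inr (Inr c))) = Inr (Inr (Inl c))"
| "gather3 (Inr (Inl c)) = Inr (Inr (Inr c))"
| "gather3 (Inr (Inr d)) = Inl (Inr d)"

definition join3 ::
  "('a, 'b) cobordism \<Rightarrow> ('b, 'c) cobordism \<Rightarrow> ('c, 'd) cobordism \<Rightarrow>
    ('a + 'd) + (('b + 'b) + ('c + 'c)) \<Rightarrow> ('a + 'd) + (('b + 'b) + ('c + 'c))"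
where
  "join3 f g h =
    restrict (gather3 \<circ> map_sum (map_sum (match f) (match g)) (match h) \<circ> split3)
      ((pos (src f) <+> neg (tgt h)) <+> (total_set (tgt f) <+> total_set (tgt g)))"

lemma bij_betw_map_sum:
  assumes "bij_betw u P Q" "bij_betw v R S"
  shows "bij_betw (map_sum u v) (P <+> R) (Q <+> S)"
proof -
  have u: "inj_on u P" "u ` P = Q" and v: "inj_on v R" "v ` R = S"
    using assms by (auto simp: bij_betw_def)
  have "x = y" if "x \<in> P <+> R" "y \<in> P <+> R" "map_sum u v x = map_sum u v y" for x y
    using that by (cases x; cases y) (auto elim!: PlusE dest: inj_onD[OF u(1)] inj_onD[OF v(1)])
  then have "inj_on (map_sum u v) (P <+> R)" by (rule inj_onI)
  moreover have "map_sum u v ` (P <+> R) = Q <+> S"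
    unfolding u(2)[symmetric] v(2)[symmetric] by (simp add: Plus_def image_Un image_image)
  ultimately show ?thesis by (simp add: bij_betw_def)
qed

lemma bij_betw_split2:
  "bij_betw split2 ((Ap <+> Cn) <+> (Bp <+> Bn)) ((Ap <+> Bn) <+> (Bp <+> Cn))"
proof -
  have "x = y" if "split2 x = split2 y" for x y
    using that by (cases x rule: split2.cases; cases y rule: split2.cases) simp_all
  then show ?thesis
    unfolding bij_betw_def
    by (intro conjI inj_onI) (assumption | simp add: Plus_def image_Un image_image Un_ac)+
qed

lemma bij_betw_gather2:
  "bij_betw gather2 ((An <+> Bp) <+> (Bn <+> Cp)) ((An <+> Cp) <+> (Bp <+> Bn))"
proof -
  have "x = y" if "gather2 x = gather2 y" for x y
    using that by (cases x rule: gather2.cases; cases y rule: gather2.cases) simp_all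
  then show ?thesis
    unfolding bij_betw_def
    by (intro conjI inj_onI) (assumption | simp add: Plus_def image_Un image_image Un_ac)+
qed

lemma bij_betw_split3:
  "bij_betw split3 ((Ap <+> Dn) <+> ((Bp <+> Bn) <+> (Cp <+> Cn)))
    (((Ap <+> Bn) <+> (Bp <+> Cn)) <+> (Cp <+> Dn))"
proof -
  have "x = y" if "split3 x = split3 y" for x y
    using that by (cases x rule: split3.cases; cases y rule: split3.cases) simp_all
  then show ?thesis
    unfolding bij_betw_def
    by (intro conjI inj_onI) (assumption | simp add: Plus_def image_Un image_image Un_ac)+
qed

lemma bij_betw_gather3:
  "bij_betw gather3 (((An <+> Bp) <+> (Bn <+> Cp)) <+> (Cn <+> Dp))
    ((An <+> Dp) <+> ((Bp <+> Bn) <+> (Cp <+> Cn)))"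
proof -
  have "x = y" if "gather3 x = gather3 y" for x y
    using that by (cases x rule: gather3.cases; cases y rule: gather3.cases) simp_all
  then show ?thesis
    unfolding bij_betw_def
    by (intro conjI inj_onI) (assumption | simp add: Plus_def image_Un image_image Un_ac)+
qed

lemma matching_join2:
  assumes "is_cobordism f A B" "is_cobordism g B C"
  shows "matching (join2 f g)
    ((pos A <+> neg C) <+> total_set B) ((neg A <+> pos C) <+> total_set B)"
proof -
  have "bij_betw (map_sum (match f) (match g))
      ((pos A <+> neg B) <+> (pos B <+> neg C)) ((neg A <+> pos B) <+> (neg B <+> pos C))"
    using assms by (intro bij_betw_map_sum) (auto simp: is_cobordism_def matching_def)
  from bij_betw_trans[OF bij_betw_trans[OF bij_betw_split2 this] bij_betw_gather2] show ?thesis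
    using assms
    by (auto simp: matching_def join2_def is_cobordism_def finite_signed_def total_set_def comp_assoc)
qed

lemma matching_join3:
  assumes "is_cobordism f A B" "is_cobordism g B C" "is_cobordism h C D"
  shows "matching (join3 f g h)
    ((pos A <+> neg D) <+> (total_set B <+> total_set C))
    ((neg A <+> pos D) <+> (total_set B <+> total_set C))"
proof -
  have "bij_betw (map_sum (map_sum (match f) (match g)) (match h))
      (((pos A <+> neg B) <+> (pos B <+> neg C)) <+> (pos C <+> neg D))
      (((neg A <+> pos B) <+> (neg B <+> pos C)) <+> (neg C <+> pos D))"
    using assms by (intro bij_betw_map_sum) (auto simp: is_cobordism_def matching_def)
  from bij_betw_trans[OF bij_betw_trans[OF bij_betw_split3 this] bij_betw_gather3] show ?thesis
    using assms
    by (auto simp: matching_def join3_def is_cobordism_def finite_signed_def total_set_def comp_assoc)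
qed

end

theory Submission
  imports Defs
begin

text \<open>
  Cancellation follows the orbit of a point until it leaves the cancelled summand. Leaving
  \<open>|B| + |C|\<close> under \<open>|f| + |g| + |h|\<close> can be done in two stages: first shorten every excursion into
  \<open>|B|\<close> to a single step, which replaces \<open>|f| + |g|\<close> by \<open>|f \<triangleleft> g|\<close>, and then leave \<open>|C|\<close>. The roles
  of \<open>|B|\<close> and \<open>|C|\<close> can be exchanged, so both iterated composites equal the simultaneous
  cancellation.
\<close>

section \<open>Orbits leaving a set\<close>

text \<open>Omits the length of the run, so that runs can be refined and concatenated by rule
  induction. The start is never tested: at least one step is taken, as \<open>0 < n\<close> in
  \<open>cancel\<close> demands, and \<open>x\<close> itself may lie in \<open>E\<close>.\<close>

inductive exits :: "('x \<Rightarrow> 'x) \<Rightarrow> 'x set \<Rightarrow> 'x \<Rightarrow> 'x \<Rightarrow> bool" for F E where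
  leave: "F x \<notin> E \<Longrightarrow> exits F E x (F x)"
| stay: "F x \<in> E \<Longrightarrow> exits F E (F x) y \<Longrightarrow> exits F E x y"

lemma exits_notin: "exits F E x y \<Longrightarrow> y \<notin> E"
  by (induction rule: exits.induct) auto

lemma exits_unique: "exits F E x y \<Longrightarrow> exits F E x z \<Longrightarrow> y = z"
proof (induction arbitrary: z rule: exits.induct)
  case (leave x)
  from leave(2) show ?case by cases (use leave(1) in auto)
next
  case (stay x y)
  from stay(4) show ?case
  proof cases
    case leave
    then show ?thesis using stay(1) by simp
  qed (rule stay.IH)
qed

lemma exits_image: "exits F E x y \<Longrightarrow> x \<in> D \<Longrightarrow> E \<subseteq> D \<Longrightarrow> y \<in> F ` D"
  by (induction rule: exits.induct) auto

text \<open>A run through \<open>E\<close> that ends inside the larger set \<open>E'\<close> has not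
  yet left \<open>E'\<close>, so the run starting at its end prolongs it.\<close>

lemma exits_mono_stay:
  "exits F E x y \<Longrightarrow> E \<subseteq> E' \<Longrightarrow> y \<in> E' \<Longrightarrow> exits F E' y z \<Longrightarrow> exits F E' x z"
proof (induction rule: exits.induct)
  case (leave x)
  then show ?case by (simp add: exits.stay)
next
  case (stay x y)
  show ?case by (rule exits.stay) (use stay in auto)
qed

lemma exits_mono_leave: "exits F E x y \<Longrightarrow> E \<subseteq> E' \<Longrightarrow> y \<notin> E' \<Longrightarrow> exits F E' x y"
proof (induction rule: exits.induct)
  case (leave x)
  then show ?case by (simp add: exits.leave)
next
  case (stay x y)
  show ?case by (rule exits.stay) (use stay in auto)
qed

text \<open>
  Two embeddings are needed since a point outside \<open>E\<close> may occupy different summands as an argument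
  and as a value.
\<close>

lemma exits_refine:
  assumes "exits H E x y" and "x \<in> D"
    and "\<And>x. x \<in> D \<Longrightarrow> exits F K (\<iota> x) (\<kappa> (H x))"
    and "\<And>x. x \<in> D \<Longrightarrow> H x \<in> E \<Longrightarrow> H x \<in> D \<and> \<kappa> (H x) = \<iota> (H x)"
    and "\<And>x. x \<in> D \<Longrightarrow> \<kappa> (H x) \<in> K' \<longleftrightarrow> H x \<in> E"
  shows "exits F (K \<union> K') (\<iota> x) (\<kappa> y)"
  using assms(1,2)
proof (induction rule: exits.induct)
  case (leave x)
  \<comment> \<open>The excursion ends outside \<open>K\<close>, and \<open>H x \<notin> E\<close>
    keeps its end outside \<open>K'\<close>.\<close>
  have "\<kappa> (H x) \<notin> K \<union> K'"
    using leave assms(5) exits_notin[OF assms(3)] by blast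
  with assms(3)[OF leave(2)] show ?case by (rule exits_mono_leave[OF _ Un_upper1])
next
  case (stay x y)
  \<comment> \<open>Inside \<open>E\<close> both embeddings agree, so the end of this excursion is
    the start of the next one.\<close>
  have H: "H x \<in> D" "\<kappa> (H x) = \<iota> (H x)" using assms(4) stay by auto
  have "\<kappa> (H x) \<in> K \<union> K'" using assms(5) stay by blast
  moreover have "exits F (K \<union> K') (\<kappa> (H x)) (\<kappa> y)" using stay.IH H by simp
  ultimately show ?case by (rule exits_mono_stay[OF assms(3)[OF stay.prems] Un_upper1])
qed

section \<open>Runs counted by iterates\<close>

lemma exits_funpow:
  "0 < n \<Longrightarrow> (F ^^ n) x \<notin> E \<Longrightarrow> (\<And>i. 0 < i \<Longrightarrow> i < n \<Longrightarrow> (F ^^ i) x \<in> E) \<Longrightarrow> exits F E x ((F ^^ n) x)"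
proof (induction n arbitrary: x)
  case (Suc n)
  show ?case
  proof (cases "n = 0")
    case True
    then show ?thesis using Suc.prems by (auto intro: exits.leave)
  next
    case False
    have "exits F E (F x) ((F ^^ n) (F x))"
    proof (rule Suc.IH)
      show "(F ^^ i) (F x) \<in> E" if "0 < i" "i < n" for i
        using Suc.prems(3)[of "Suc i"] that by (simp add: funpow_Suc_right del: funpow.simps(2))
    qed (use False Suc.prems in \<open>auto simp: funpow_Suc_right simp del: funpow.simps(2)\<close>)
    moreover have "F x \<in> E" using Suc.prems(3)[of 1] False by simp
    ultimately show ?thesis by (simp add: funpow_Suc_right exits.stay del: funpow.simps(2))
  qed
qed simp

text \<open>Recovers the number of steps, since injectivity is proved by comparing the lengths of
  two runs.\<close>

lemma exits_imp_funpow: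
  "exits F E x y \<Longrightarrow> \<exists>n. y = (F ^^ Suc n) x \<and> (\<forall>i. 0 < i \<longrightarrow> i \<le> n \<longrightarrow> (F ^^ i) x \<in> E)"
proof (induction rule: exits.induct)
  case (leave x)
  show ?case by (rule exI[of _ 0]) simp
next
  case (stay x y)
  then obtain n where n: "y = (F ^^ Suc n) (F x)" "\<forall>i. 0 < i \<longrightarrow> i \<le> n \<longrightarrow> (F ^^ i) (F x) \<in> E"
    by blast
  have "(F ^^ i) x \<in> E" if "0 < i" "i \<le> Suc n" for i
  proof (cases "i = 1")
    case False
    then obtain k where "i = Suc k" "0 < k" "k \<le> n" using \<open>0 < i\<close> \<open>i \<le> Suc n\<close> by (cases i) auto
    then show ?thesis using n(2) by (simp add: funpow_Suc_right del: funpow.simps(2))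
  qed (use stay(1) in simp)
  moreover have "y = (F ^^ Suc (Suc n)) x"
    unfolding n(1) funpow_Suc_right[of "Suc n"] by simp
  ultimately show ?case by blast
qed

text \<open>Peels off applications of \<open>F\<close> from the outside. As \<open>F\<close> is
  injective only on \<open>D\<close>, the iterates before the last must stay there; the common last
  value may lie outside \<open>D\<close>.\<close>

lemma inj_on_funpow_cancel:
  assumes "inj_on F D"
  shows "(\<And>i. i < k \<Longrightarrow> (F ^^ i) x \<in> D \<and> (F ^^ i) y \<in> D) \<Longrightarrow> (F ^^ k) x = (F ^^ k) y \<Longrightarrow> x = y"
proof (induction k)
  case (Suc k)
  have "(F ^^ k) x = (F ^^ k) y"
    using Suc.prems(1)[of k] Suc.prems(2) inj_onD[OF assms] by simp
  then show ?case using Suc by simp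
qed simp

text \<open>Pigeonhole: an orbit trapped in the finite set \<open>E\<close> repeats a value, and by
  injectivity it then returns to its start \<open>x\<close>, which is outside
  \<open>E\<close>.\<close>

lemma ex_funpow_notin:
  assumes "inj_on F D" "E \<subseteq> D" "finite E" "x \<in> D" "x \<notin> E"
  shows "\<exists>n>0. (F ^^ n) x \<notin> E"
proof (rule ccontr)
  assume "\<not> ?thesis"
  then have E: "(F ^^ n) x \<in> E" if "0 < n" for n using that by blast
  then have D: "(F ^^ n) x \<in> D" for n using assms by (cases "n = 0") auto
  have "range (\<lambda>n. (F ^^ Suc n) x) \<subseteq> E" using E by blast
  then have "\<not> inj (\<lambda>n. (F ^^ Suc n) x)"
    using assms(3) finite_subset finite_imageD infinite_UNIV_nat by metis
  then obtain i j where "i < j" and ij: "(F ^^ Suc i) x = (F ^^ Suc j) x"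
    unfolding inj_on_def by (metis linorder_neqE_nat)
  \<comment> \<open>Splitting the later index as \<open>Suc i\<close> plus \<open>j - i\<close>
    exposes \<open>Suc i\<close> common applications to cancel.\<close>
  have "(F ^^ Suc i) x = (F ^^ (Suc i + (j - i))) x" using ij \<open>i < j\<close> by simp
  then have "(F ^^ Suc i) x = (F ^^ Suc i) ((F ^^ (j - i)) x)" unfolding funpow_add o_apply .
  then have "x = (F ^^ (j - i)) x"
  proof (rule inj_on_funpow_cancel[OF assms(1), rotated])
    show "(F ^^ k) x \<in> D \<and> (F ^^ k) ((F ^^ (j - i)) x) \<in> D" for k
      using D[of k] D[of "k + (j - i)"] by (simp add: funpow_add)
  qed
  then show False using E[of "j - i"] \<open>i < j\<close> assms(5) by simp
qed

text \<open>Two runs with the same end are followed backwards until the shorter is used up. Its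
  start then lies on the longer run, and as it is outside \<open>E\<close> it can only be the start
  of that run.\<close>

lemma exits_inj:
  assumes "inj_on F D" "E \<subseteq> D" "x \<in> D - E" "y \<in> D - E" "exits F E x z" "exits F E y z"
  shows "x = y"
proof -
  \<comment> \<open>Quantified over both points and both lengths, so that exchanging the runs covers
    the opposite order of lengths.\<close>
  have le: "x = y"
    if "n \<le> m" and xy: "x \<in> D - E" "y \<in> D - E"
      and n: "\<forall>i. 0 < i \<longrightarrow> i \<le> n \<longrightarrow> (F ^^ i) x \<in> E"
      and m: "\<forall>i. 0 < i \<longrightarrow> i \<le> m \<longrightarrow> (F ^^ i) y \<in> E"
      and eq: "(F ^^ Suc n) x = (F ^^ Suc m) y" for n m x y
  proof -
    have orbit_x: "(F ^^ i) x \<in> D" if "i < Suc n" for i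
      using n xy assms(2) that by (cases "i = 0") auto
    \<comment> \<open>Index \<open>0\<close> is separate: the start \<open>y\<close> is in
      \<open>D\<close> but not in \<open>E\<close>.\<close>
    have orbit_y: "(F ^^ i) ((F ^^ (m - n)) y) \<in> D" if "i < Suc n" for i
    proof -
      have "(F ^^ (i + (m - n))) y \<in> D"
      proof (cases "i + (m - n) = 0")
        case True
        then show ?thesis using xy by (simp only: funpow.simps) simp
      next
        case False
        have "i + (m - n) \<le> m" using that \<open>n \<le> m\<close> by simp
        with m False have "(F ^^ (i + (m - n))) y \<in> E" by (simp only: neq0_conv)
        then show ?thesis by (rule subsetD[OF assms(2)])
      qed
      then show ?thesis by (simp add: funpow_add)
    qed
    have "(F ^^ Suc n) x = (F ^^ (Suc n + (m - n))) y" using eq \<open>n \<le> m\<close> by simp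
    then have "(F ^^ Suc n) x = (F ^^ Suc n) ((F ^^ (m - n)) y)" unfolding funpow_add o_apply .
    then have "x = (F ^^ (m - n)) y"
      by (rule inj_on_funpow_cancel[OF assms(1), rotated]) (intro conjI orbit_x orbit_y)
    \<comment> \<open>If \<open>m \<noteq> n\<close>, then \<open>x\<close> is an intermediate point
      of the run from \<open>y\<close>, hence in \<open>E\<close>.\<close>
    then show ?thesis using m xy \<open>n \<le> m\<close> by (cases "m = n") auto
  qed
  obtain n where n: "z = (F ^^ Suc n) x" "\<forall>i. 0 < i \<longrightarrow> i \<le> n \<longrightarrow> (F ^^ i) x \<in> E"
    using exits_imp_funpow[OF assms(5)] by blast
  obtain m where m: "z = (F ^^ Suc m) y" "\<forall>i. 0 < i \<longrightarrow> i \<le> m \<longrightarrow> (F ^^ i) y \<in> E"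
    using exits_imp_funpow[OF assms(6)] by blast
  show ?thesis
  proof (cases "n \<le> m")
    case True
    then show ?thesis using le[OF _ assms(3,4) n(2) m(2)] n m by simp
  next
    case False
    then show ?thesis using le[OF _ assms(4,3) m(2) n(2)] n m by simp
  qed
qed

section \<open>Cancellation of matchings\<close>

text \<open>Makes \<open>LEAST\<close> and \<open>projl\<close> in \<open>cancel\<close> meaningful:
  the orbit does leave \<open>E\<close>, and its exit carries the tag \<open>Inl\<close>.\<close>

lemma exits_cancel:
  assumes "matching F (P <+> E) (Q <+> E)" and p: "p \<in> P"
  shows "exits F (Inr ` E) (Inl p) (Inl (cancel P E F p))" and "cancel P E F p \<in> Q"
proof -
  have F: "inj_on F (P <+> E)" "F ` (P <+> E) = Q <+> E" "finite E"
    using assms by (auto simp: matching_def bij_betw_def finite_Plus_iff)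
  let ?R = "\<lambda>n. 0 < n \<and> (F ^^ n) (Inl p) \<notin> Inr ` E"
  have "\<exists>n. ?R n"
    using ex_funpow_notin[OF F(1), of "Inr ` E" "Inl p"] F(3) p by auto
  then have least: "?R (LEAST n. ?R n)" by (rule LeastI_ex)
  moreover have "(F ^^ i) (Inl p) \<in> Inr ` E" if "0 < i" "i < (LEAST n. ?R n)" for i
    using not_less_Least[OF that(2)] that(1) by blast
  ultimately have ex: "exits F (Inr ` E) (Inl p) ((F ^^ (LEAST n. ?R n)) (Inl p))"
    by (intro exits_funpow) auto
  \<comment> \<open>The exit is a value of \<open>F\<close> on \<open>P <+> E\<close>; avoiding
    \<open>E\<close>, it must come from \<open>Q\<close>.\<close>
  have "(F ^^ (LEAST n. ?R n)) (Inl p) \<in> Q <+> E"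
    using exits_image[OF ex, of "P <+> E"] F(2) p by auto
  then have "(F ^^ (LEAST n. ?R n)) (Inl p) = Inl (cancel P E F p) \<and> cancel P E F p \<in> Q"
    using least p by (auto simp: cancel_def elim!: PlusE)
  with ex show "exits F (Inr ` E) (Inl p) (Inl (cancel P E F p))" "cancel P E F p \<in> Q" by auto
qed

text \<open>Injectivity is that of exits; surjectivity follows by counting, as removing
  \<open>E\<close> from both sides leaves \<open>card P = card Q\<close>.\<close>

lemma matching_cancel:
  assumes "matching F (P <+> E) (Q <+> E)"
  shows "matching (cancel P E F) P Q"
proof -
  have F: "bij_betw F (P <+> E) (Q <+> E)" "inj_on F (P <+> E)" "finite P" "finite Q" "finite E"
    using assms by (auto simp: matching_def bij_betw_def finite_Plus_iff)
  have inj: "inj_on (cancel P E F) P"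
  proof (rule inj_onI)
    fix p q assume "p \<in> P" "q \<in> P" and eq: "cancel P E F p = cancel P E F q"
    then have "(Inl p :: 'a + 'b) = Inl q"
      using exits_cancel(1)[OF assms \<open>p \<in> P\<close>] exits_cancel(1)[OF assms \<open>q \<in> P\<close>]
      by (intro exits_inj[OF F(2), of "Inr ` E"]) auto
    then show "p = q" by simp
  qed
  moreover have "cancel P E F ` P \<subseteq> Q" using exits_cancel(2)[OF assms] by blast
  moreover have "card P = card Q"
    using bij_betw_same_card[OF F(1)] F(3-5) by (simp add: card_Plus)
  ultimately have "bij_betw (cancel P E F) P Q"
    using F(3,4) by (simp add: bij_betw_def card_image card_subset_eq)
  then show ?thesis using F by (simp add: matching_def cancel_def)
qed

text \<open>One direction suffices: every point of \<open>P\<close> has an exit under each map, and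
  exits are unique.\<close>

lemma cancel_eqI:
  assumes F: "matching F (P <+> E) (Q <+> E)" and G: "matching G (P <+> E') (Q <+> E')"
    and "\<And>p q. p \<in> P \<Longrightarrow> exits F (Inr ` E) (Inl p) (Inl q) \<Longrightarrow> exits G (Inr ` E') (Inl p) (Inl q)"
  shows "cancel P E F = cancel P E' G"
proof
  fix p
  show "cancel P E F p = cancel P E' G p"
  proof (cases "p \<in> P")
    case True
    from exits_unique[OF assms(3)[OF True exits_cancel(1)[OF F True]] exits_cancel(1)[OF G True]]
    show ?thesis by simp
  qed (simp add: cancel_def)
qed

section \<open>Composition of two cobordisms\<close>

lemma is_cobordism_compose:
  assumes "is_cobordism f A B" "is_cobordism g B C"
  shows "is_cobordism (f \<triangleleft> g) A C"
  using matching_cancel[OF matching_join2[OF assms]] assms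
  by (auto simp: is_cobordism_def compose_cob_def)

lemma exits_join2_compose:
  assumes "is_cobordism f A B" "is_cobordism g B C" "w \<in> pos A <+> neg C"
  shows "exits (join2 f g) (Inr ` total_set B) (Inl w) (Inl (match (f \<triangleleft> g) w))"
  using exits_cancel(1)[OF matching_join2[OF assms(1,2)] assms(3)] assms(1,2)
  by (simp add: compose_cob_def is_cobordism_def)

lemma join2_apply:
  assumes "is_cobordism f A B" "is_cobordism g B C"
    and "x \<in> (pos A <+> neg C) <+> (pos B <+> neg B)"
  shows "join2 f g x = gather2 (map_sum (match f) (match g) (split2 x))"
  using assms by (simp add: join2_def is_cobordism_def total_set_def)

lemma join3_apply:
  assumes "is_cobordism f A B" "is_cobordism g B C" "is_cobordism h C D"
    and "x \<in> (pos A <+> neg D) <+> ((pos B <+> neg B) <+> (pos C <+> neg C))"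
  shows "join3 f g h x = gather3 (map_sum (map_sum (match f) (match g)) (match h) (split3 x))"
  using assms by (simp add: join3_def is_cobordism_def total_set_def)

section \<open>Embedding two factors into the triple sum\<close>

text \<open>Places \<open>|f| + |g|\<close> inside the triple sum. On \<open>C\<close> an argument
  belongs to the negative part and a value to the positive part, which is why
  \<open>left_val\<close> differs from this embedding there.\<close>

fun left_arg :: "('a + 'c) + ('b + 'b) \<Rightarrow> ('a + 'd) + (('b + 'b) + ('c + 'c))" where
  "left_arg (Inl (Inl a)) = Inl (Inl a)"
| "left_arg (Inl (Inr c)) = Inr (Inr (Inr c))"
| "left_arg (Inr b) = Inr (Inl b)"

fun left_val :: "('a + 'c) + ('b + 'b) \<Rightarrow> ('a + 'd) + (('b + 'b) + ('c + 'c))" where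
  "left_val (Inl (Inl a)) = Inl (Inl a)"
| "left_val (Inl (Inr c)) = Inr (Inr (Inl c))"
| "left_val (Inr b) = Inr (Inl b)"

text \<open>Places \<open>|g| + |h|\<close>; now \<open>B\<close> is the boundary, with positive
  arguments and, in \<open>right_val\<close>, negative values.\<close>

fun right_arg :: "('b + 'd) + ('c + 'c) \<Rightarrow> ('a + 'd) + (('b + 'b) + ('c + 'c))" where
  "right_arg (Inl (Inl b)) = Inr (Inl (Inl b))"
| "right_arg (Inl (Inr d)) = Inl (Inr d)"
| "right_arg (Inr c) = Inr (Inr c)"

fun right_val :: "('b + 'd) + ('c + 'c) \<Rightarrow> ('a + 'd) + (('b + 'b) + ('c + 'c))" where
  "right_val (Inl (Inl b)) = Inr (Inl (Inr b))"
| "right_val (Inl (Inr d)) = Inl (Inr d)"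
| "right_val (Inr c) = Inr (Inr c)"

lemma split3_left_arg: "split3 (left_arg v) = Inl (split2 v)"
  by (cases v rule: split2.cases) auto

lemma gather3_left: "gather3 (Inl u) = left_val (gather2 u)"
  by (cases u rule: gather2.cases) auto

text \<open>The triple sum is bracketed to the left, so the pair \<open>g\<close>, \<open>h\<close>
  straddles the brackets and enters by \<open>map_sum Inr id\<close> rather than by one
  injection.\<close>

lemma split3_right_arg: "split3 (right_arg v) = map_sum Inr id (split2 v)"
  by (cases v rule: split2.cases) auto

lemma gather3_right: "gather3 (map_sum Inr id u) = right_val (gather2 u)"
  by (cases u rule: gather2.cases) auto

text \<open>One application of \<open>f \<triangleleft> g\<close> is an excursion into
  \<open>|B|\<close> of the triple join.\<close>

lemma exits_join3_left:
  assumes f: "is_cobordism f A B" and g: "is_cobordism g B C" and h: "is_cobordism h C D"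
    and w: "w \<in> pos A <+> neg C"
  shows "exits (join3 f g h) (Inr ` Inl ` total_set B)
    (left_arg (Inl w)) (left_val (Inl (match (f \<triangleleft> g) w)))"
proof -
  let ?D = "(pos A <+> neg C) <+> total_set B"
  have step: "join3 f g h (left_arg v) = left_val (join2 f g v)" if "v \<in> ?D" for v
  proof -
    have "left_arg v \<in> (pos A <+> neg D) <+> ((pos B <+> neg B) <+> (pos C <+> neg C))"
      using that by (cases v rule: split2.cases) (auto simp: total_set_def)
    then show ?thesis
      using that
      by (simp add: join2_apply[OF f g] join3_apply[OF f g h] total_set_def split3_left_arg
          flip: gather3_left)
  qed
  have "exits (join3 f g h) ({} \<union> Inr ` Inl ` total_set B)
    (left_arg (Inl w)) (left_val (Inl (match (f \<triangleleft> g) w)))"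
  proof (rule exits_refine[OF exits_join2_compose[OF f g w]])
    show "Inl w \<in> ?D" using w by blast
    \<comment> \<open>With the empty set a run is exactly one step, so the refinement merely
      transports the run along the embeddings.\<close>
    show "exits (join3 f g h) {} (left_arg v) (left_val (join2 f g v))" if "v \<in> ?D" for v
      using exits.leave[of "join3 f g h" "left_arg v" "{}"] step[OF that] by simp
    show "join2 f g v \<in> ?D \<and> left_val (join2 f g v) = left_arg (join2 f g v)"
      if "v \<in> ?D" "join2 f g v \<in> Inr ` total_set B" for v
      using that by auto
    show "left_val (join2 f g v) \<in> Inr ` Inl ` total_set B
        \<longleftrightarrow> join2 f g v \<in> Inr ` total_set B" for v
      by (cases "join2 f g v" rule: left_val.cases) auto
  qed
  then show ?thesis by simp
qed

lemma exits_join3_right: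
  assumes f: "is_cobordism f A B" and g: "is_cobordism g B C" and h: "is_cobordism h C D"
    and w: "w \<in> pos B <+> neg D"
  shows "exits (join3 f g h) (Inr ` Inr ` total_set C)
    (right_arg (Inl w)) (right_val (Inl (match (g \<triangleleft> h) w)))"
proof -
  let ?D = "(pos B <+> neg D) <+> total_set C"
  have step: "join3 f g h (right_arg v) = right_val (join2 g h v)" if "v \<in> ?D" for v
  proof -
    have "right_arg v \<in> (pos A <+> neg D) <+> ((pos B <+> neg B) <+> (pos C <+> neg C))"
      using that by (cases v rule: split2.cases) (auto simp: total_set_def)
    then show ?thesis
      using that
      \<comment> \<open>The case split lets \<open>map_sum Inr id\<close> pass through the sum of
        the three matchings.\<close>
      by (cases "split2 v") (simp_all add: join2_apply[OF g h] join3_apply[OF f g h] total_set_def split3_right_arg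
          gather3_right[symmetric])
  qed
  have "exits (join3 f g h) ({} \<union> Inr ` Inr ` total_set C)
    (right_arg (Inl w)) (right_val (Inl (match (g \<triangleleft> h) w)))"
  proof (rule exits_refine[OF exits_join2_compose[OF g h w]])
    show "Inl w \<in> ?D" using w by blast
    show "exits (join3 f g h) {} (right_arg v) (right_val (join2 g h v))" if "v \<in> ?D" for v
      using exits.leave[of "join3 f g h" "right_arg v" "{}"] step[OF that] by simp
    show "join2 g h v \<in> ?D \<and> right_val (join2 g h v) = right_arg (join2 g h v)"
      if "v \<in> ?D" "join2 g h v \<in> Inr ` total_set C" for v
      using that by auto
    show "right_val (join2 g h v) \<in> Inr ` Inr ` total_set C
        \<longleftrightarrow> join2 g h v \<in> Inr ` total_set C" for v
      by (cases "join2 g h v" rule: right_val.cases) auto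
  qed
  then show ?thesis by simp
qed

section \<open>Cancellation in two stages\<close>

text \<open>A value of \<open>f \<triangleleft> g\<close> reaches the same place of the triple sum
  directly or by way of the join with \<open>h\<close>.\<close>

lemma left_val_gather2: "left_val (Inl u) = map_sum id Inr (gather2 (Inl u))"
  by (cases u) auto

lemma right_val_gather2: "right_val (Inl u) = map_sum id Inl (gather2 (Inr u))"
  by (cases u) auto

text \<open>Each step of the join of \<open>f \<triangleleft> g\<close> and \<open>h\<close> expands
  to a run of the triple join through \<open>|B|\<close>; chaining these runs until
  \<open>|C|\<close> is left gives a run through both.\<close>

lemma match_compose_left:
  assumes f: "is_cobordism f A B" and g: "is_cobordism g B C" and h: "is_cobordism h C D"
  shows "match ((f \<triangleleft> g) \<triangleleft> h) =
    cancel (pos A <+> neg D) (total_set B <+> total_set C) (join3 f g h)"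
proof -
  note fg = is_cobordism_compose[OF f g]
  let ?H = "join2 (f \<triangleleft> g) h" and ?D = "(pos A <+> neg D) <+> total_set C"
  let ?\<iota> = "map_sum id Inr :: _ \<Rightarrow> ('a + 'd) + (('b + 'b) + ('c + 'c))"
  have K: "Inr ` Inl ` total_set B \<union> Inr ` Inr ` total_set C = Inr ` (total_set B <+> total_set C)"
    by (auto simp: Plus_def)
  have step: "exits (join3 f g h) (Inr ` Inl ` total_set B) (?\<iota> x) (?\<iota> (?H x))"
    if x: "x \<in> ?D" for x
  proof (cases "split2 x")
    \<comment> \<open>The point is moved by \<open>f \<triangleleft> g\<close>: the step expands to
      an excursion into \<open>|B|\<close>.\<close>
    case (Inl w)
    have "w \<in> pos A <+> neg C" "?\<iota> x = left_arg (Inl w)"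
      using x Inl by (cases x rule: split2.cases; auto simp: total_set_def)+
    moreover have "?\<iota> (?H x) = left_val (Inl (match (f \<triangleleft> g) w))"
      using x Inl by (simp add: join2_apply[OF fg h] total_set_def left_val_gather2)
    ultimately show ?thesis using exits_join3_left[OF f g h] by simp
  next
    \<comment> \<open>The point is moved by \<open>h\<close>: one step suffices, as the image of
      \<open>?\<iota>\<close> misses \<open>|B|\<close>.\<close>
    case (Inr w)
    have "?\<iota> x \<in> (pos A <+> neg D) <+> ((pos B <+> neg B) <+> (pos C <+> neg C))"
      using x by (cases x) (auto simp: total_set_def)
    note j3 = join3_apply[OF f g h this]
    have "join3 f g h (?\<iota> x) = ?\<iota> (?H x)"
      unfolding j3 using x Inr
      by (cases x rule: split2.cases; cases "match h w")
        (auto simp: join2_apply[OF fg h] total_set_def)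
    moreover have "?\<iota> (?H x) \<notin> Inr ` Inl ` total_set B" by (cases "?H x") auto
    ultimately show ?thesis by (metis exits.leave)
  qed
  have "exits (join3 f g h) (Inr ` (total_set B <+> total_set C)) (Inl p) (Inl q)"
    if p: "p \<in> pos A <+> neg D" and ex: "exits ?H (Inr ` total_set C) (Inl p) (Inl q)" for p q
  proof -
    have "exits (join3 f g h) (Inr ` Inl ` total_set B \<union> Inr ` Inr ` total_set C)
      (?\<iota> (Inl p)) (?\<iota> (Inl q))"
    \<comment> \<open>Here \<open>?\<iota>\<close> serves both as the embedding of arguments and as
      that of values.\<close>
    proof (rule exits_refine[OF ex])
      show "Inl p \<in> ?D" using p by blast
      show "?\<iota> (?H x) \<in> Inr ` Inr ` total_set C \<longleftrightarrow> ?H x \<in> Inr ` total_set C" for x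
        by (cases "?H x") auto
    qed (use step in blast, auto)
    then show ?thesis unfolding K by simp
  qed
  then show ?thesis
    using cancel_eqI[OF matching_join2[OF fg h] matching_join3[OF f g h]] fg h
    by (simp add: compose_cob_def[of "f \<triangleleft> g"] is_cobordism_def)
qed

text \<open>The mirror image: excursions into \<open>|C|\<close> are expanded first, and the
  resulting runs are chained until \<open>|B|\<close> is left.\<close>

lemma match_compose_right:
  assumes f: "is_cobordism f A B" and g: "is_cobordism g B C" and h: "is_cobordism h C D"
  shows "match (f \<triangleleft> (g \<triangleleft> h)) =
    cancel (pos A <+> neg D) (total_set B <+> total_set C) (join3 f g h)"
proof -
  note gh = is_cobordism_compose[OF g h]
  let ?H = "join2 f (g \<triangleleft> h)" and ?D = "(pos A <+> neg D) <+> total_set B"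
  let ?\<iota> = "map_sum id Inl :: _ \<Rightarrow> ('a + 'd) + (('b + 'b) + ('c + 'c))"
  have K: "Inr ` Inr ` total_set C \<union> Inr ` Inl ` total_set B = Inr ` (total_set B <+> total_set C)"
    by (auto simp: Plus_def)
  have step: "exits (join3 f g h) (Inr ` Inr ` total_set C) (?\<iota> x) (?\<iota> (?H x))"
    if x: "x \<in> ?D" for x
  proof (cases "split2 x")
    case (Inr w)
    have "w \<in> pos B <+> neg D" "?\<iota> x = right_arg (Inl w)"
      using x Inr by (cases x rule: split2.cases; auto simp: total_set_def)+
    moreover have "?\<iota> (?H x) = right_val (Inl (match (g \<triangleleft> h) w))"
      using x Inr by (simp add: join2_apply[OF f gh] total_set_def right_val_gather2)
    ultimately show ?thesis using exits_join3_right[OF f g h] by simp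
  next
    case (Inl w)
    have "?\<iota> x \<in> (pos A <+> neg D) <+> ((pos B <+> neg B) <+> (pos C <+> neg C))"
      using x by (cases x) (auto simp: total_set_def)
    note j3 = join3_apply[OF f g h this]
    have "join3 f g h (?\<iota> x) = ?\<iota> (?H x)"
      unfolding j3 using x Inl
      by (cases x rule: split2.cases; cases "match f w")
        (auto simp: join2_apply[OF f gh] total_set_def)
    moreover have "?\<iota> (?H x) \<notin> Inr ` Inr ` total_set C" by (cases "?H x") auto
    ultimately show ?thesis by (metis exits.leave)
  qed
  have "exits (join3 f g h) (Inr ` (total_set B <+> total_set C)) (Inl p) (Inl q)"
    if p: "p \<in> pos A <+> neg D" and ex: "exits ?H (Inr ` total_set B) (Inl p) (Inl q)" for p q
  proof -
    have "exits (join3 f g h) (Inr ` Inr ` total_set C \<union> Inr ` Inl ` total_set B)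
      (?\<iota> (Inl p)) (?\<iota> (Inl q))"
    proof (rule exits_refine[OF ex])
      show "Inl p \<in> ?D" using p by blast
      show "?\<iota> (?H x) \<in> Inr ` Inl ` total_set B \<longleftrightarrow> ?H x \<in> Inr ` total_set B" for x
        by (cases "?H x") auto
    qed (use step in blast, auto)
    then show ?thesis unfolding K by simp
  qed
  then show ?thesis
    using cancel_eqI[OF matching_join2[OF f gh] matching_join3[OF f g h]] f gh
    by (simp add: compose_cob_def[of f "g \<triangleleft> h"] is_cobordism_def)
qed

theorem corollary3:
  fixes A :: "'a signed_set" and B :: "'b signed_set"
    and C :: "'c signed_set" and D :: "'d signed_set"
    and f :: "('a, 'b) cobordism" and g :: "('b, 'c) cobordism" and h :: "('c, 'd) cobordism"
  assumes "is_cobordism f A B" and "is_cobordism g B C" and "is_cobordism h C D"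
  shows "(f \<triangleleft> g) \<triangleleft> h = f \<triangleleft> (g \<triangleleft> h)
    \<and> is_cobordism ((f \<triangleleft> g) \<triangleleft> h) A D
    \<and> match ((f \<triangleleft> g) \<triangleleft> h) =
        cancel (pos A <+> neg D) (total_set B <+> total_set C) (join3 f g h)
    \<and> matching (cancel (pos A <+> neg D) (total_set B <+> total_set C) (join3 f g h))
        (pos A <+> neg D) (neg A <+> pos D)"
proof (intro conjI)
  show "(f \<triangleleft> g) \<triangleleft> h = f \<triangleleft> (g \<triangleleft> h)"
  proof (rule cobordism.expand)
    \<comment> \<open>Sources and targets agree by definition; the two matchings agree because both
      equal the simultaneous cancellation.\<close>
    show "match ((f \<triangleleft> g) \<triangleleft> h) = match (f \<triangleleft> (g \<triangleleft> h)) \<and>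
        src ((f \<triangleleft> g) \<triangleleft> h) = src (f \<triangleleft> (g \<triangleleft> h)) \<and>
        tgt ((f \<triangleleft> g) \<triangleleft> h) = tgt (f \<triangleleft> (g \<triangleleft> h))"
      using match_compose_left[OF assms] match_compose_right[OF assms]
      by (simp add: compose_cob_def)
  qed
  show "is_cobordism ((f \<triangleleft> g) \<triangleleft> h) A D"
    using assms by (blast intro: is_cobordism_compose)
  show "match ((f \<triangleleft> g) \<triangleleft> h) =
      cancel (pos A <+> neg D) (total_set B <+> total_set C) (join3 f g h)"
    by (rule match_compose_left[OF assms])
  show "matching (cancel (pos A <+> neg D) (total_set B <+> total_set C) (join3 f g h))
      (pos A <+> neg D) (neg A <+> pos D)"
    by (rule matching_cancel[OF matching_join3[OF assms]])
qed

end
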